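(* Let $\hat P(x)=a_0x^n+a_1x^{n-1}+\dots+a_n$ be a generic polynomial over a division algebra $R$, with roots $x_1,\dots,x_n$. Let $A\subset\{1,\dots,n\}$ with $|A|<n-1$. Then for any distinct $i,j\in\{1,\dots,n\}\setminus A$, $$x_{A\cup\{i\},j}+x_{A,i}=x_{A\cup\{j\},i}+x_{A,j},$$ $$x_{A\cup\{i\},j}\,x_{A,i}=x_{A\cup\{j\},i}\,x_{A,j}.$$
   Context: $R$ is a division algebra over a field of characteristic zero; $x$ is a formal variable not commuting with the coefficients $a_i\in R$, $a_0\ne0$. A root of $\hat P$ is $\xi\in R$ with $a_0\xi^n+a_1\xi^{n-1}+\dots+a_n=0$. For an $m\times m$ matrix $X=(x_{ij})$ over $R$, let $X^{ij}$ be $X$ with row $i$ and column $j$ removed. If $X^{ij}$ is invertible, the quasideterminant is $|X|_{ij}=x_{ij}-\rho\,(X^{ij})^{-1}\gamma$, where $\rho$ is the $i$-th row of $X$ without its $j$-th entry and $\gamma$ is the $j$-th column without its $i$-th entry (for $m=1$, $|X|_{11}=x_{11}$). For $y_1,\dots,y_m\in R$, $V(y_1,\dots,y_m)=|\tilde V|_{1m}$, where $\tilde V$ is the $m\times m$ matrix whose $(p,q)$ entry is $y_q^{m-p}$. It does not depend on the ordering of $y_1,\dots,y_{m-1}$. For elements $x_1,\dots,x_n\in R$ put $x_{\emptyset,i}=x_i$ and, for $A=\{i_1,\dots,i_m\}\subset\{1,\dots,n\}$ nonempty and $i\notin A$, $$x_{A,i}=V(x_{i_1},\dots,x_{i_m},x_i)\,x_i\,V(x_{i_1},\dots,x_{i_m},x_i)^{-1},$$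 also written $x_{i_1\dots i_m,i}$. The polynomial $\hat P$ is generic if it has exactly $n$ roots $x_1,\dots,x_n$ in $R$, and all expressions $x_{A,i}$ ($A\subset\{1,\dots,n\}$, $i\notin A$) are defined (all quasideterminants and inverses involved exist) and are different from each other. *)

theory Defs
  imports Complex_Main "Jordan_Normal_Form.Determinant"
begin

text \<open>The ground field is an explicit parameter; its scalars are central in the algebra.\<close>

locale division_algebra = vector_space scale
  for scale :: "'k::field \<Rightarrow> 'a::division_ring \<Rightarrow> 'a" +
  assumes scale_mult_left: "scale c x * y = scale c (x * y)"
    and scale_mult_right: "x * scale c y = scale c (x * y)"

text \<open>The type class operations on matrices keep the order of the factors, so products are the
  usual ones over a noncommutative ring. Matrix indices start at 0.\<close>

definition mat_inv :: "'a::division_ring mat \<Rightarrow> 'a mat" where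
  "mat_inv M = (THE N. inverts_mat M N \<and> inverts_mat N M)"

definition quasidet_defined :: "'a::division_ring mat \<Rightarrow> nat \<Rightarrow> nat \<Rightarrow> bool" where
  "quasidet_defined X i j \<longleftrightarrow>
     square_mat X \<and> i < dim_row X \<and> j < dim_col X \<and> invertible_mat (mat_delete X i j)"

text \<open>For a 1-by-1 matrix the deleted matrix is the (invertible) 0-by-0 matrix, and the
  quasideterminant is the entry.\<close>

definition quasidet :: "'a::division_ring mat \<Rightarrow> nat \<Rightarrow> nat \<Rightarrow> 'a" where
  "quasidet X i j =
     (let \<rho> = vec (dim_col X - 1) (\<lambda>q. X $$ (i, insert_index j q));
          \<gamma> = vec (dim_row X - 1) (\<lambda>p. X $$ (insert_index i p, j))
      in X $$ (i, j) - \<rho> \<bullet> (mat_inv (mat_delete X i j) *\<^sub>v \<gamma>))"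

definition vandermonde_mat :: "'a::division_ring list \<Rightarrow> 'a mat" where
  "vandermonde_mat ys =
     mat (length ys) (length ys) (\<lambda>(p, q). (ys ! q) ^ (length ys - 1 - p))"

definition V_defined :: "'a::division_ring list \<Rightarrow> bool" where
  "V_defined ys \<longleftrightarrow> quasidet_defined (vandermonde_mat ys) 0 (length ys - 1)"

definition V :: "'a::division_ring list \<Rightarrow> 'a" where
  "V ys = quasidet (vandermonde_mat ys) 0 (length ys - 1)"

text \<open>Permuting all entries of the argument of \<open>V\<close> but the last changes neither its value nor
  whether it is defined, so the elements of the index set may be listed in increasing order.\<close>

definition pseudo_args :: "(nat \<Rightarrow> 'a) \<Rightarrow> nat set \<Rightarrow> nat \<Rightarrow> 'a list" where
  "pseudo_args x A i = map x (sorted_list_of_set A @ [i])"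

definition pseudo_root_defined :: "(nat \<Rightarrow> 'a::division_ring) \<Rightarrow> nat set \<Rightarrow> nat \<Rightarrow> bool" where
  "pseudo_root_defined x A i \<longleftrightarrow>
     A = {} \<or> V_defined (pseudo_args x A i) \<and> V (pseudo_args x A i) \<noteq> 0"

definition pseudo_root :: "(nat \<Rightarrow> 'a::division_ring) \<Rightarrow> nat set \<Rightarrow> nat \<Rightarrow> 'a" where
  "pseudo_root x A i =
     (if A = {} then x i
      else V (pseudo_args x A i) * x i * inverse (V (pseudo_args x A i)))"

text \<open>A polynomial of degree \<open>n\<close> whose variable does not commute with the coefficients is given
  by its coefficients, \<open>a k\<close> being the left coefficient of the power \<open>n - k\<close>. Values of \<open>a\<close>
  beyond \<open>n\<close> and of \<open>x\<close> outside \<open>{1..n}\<close> are irrelevant.\<close>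

definition nc_roots :: "nat \<Rightarrow> (nat \<Rightarrow> 'a::division_ring) \<Rightarrow> 'a set" where
  "nc_roots n a = {\<xi>. (\<Sum>k\<le>n. a k * \<xi> ^ (n - k)) = 0}"

definition generic_poly ::
  "nat \<Rightarrow> (nat \<Rightarrow> 'a::division_ring) \<Rightarrow> (nat \<Rightarrow> 'a) \<Rightarrow> bool" where
  "generic_poly n a x \<longleftrightarrow>
     bij_betw x {1..n} (nc_roots n a) \<and>
     (\<forall>A i. A \<subseteq> {1..n} \<and> i \<in> {1..n} - A \<longrightarrow> pseudo_root_defined x A i) \<and>
     inj_on (\<lambda>(A, i). pseudo_root x A i) {(A, i). A \<subseteq> {1..n} \<and> i \<in> {1..n} - A}"

end

theory Submission
  imports Defs
begin

text \<open>
  Deleting the top row and last column of the Vandermonde matrix of \<open>ys @ [\<xi>]\<close> leaves the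
  Vandermonde matrix of \<open>ys\<close>, in which \<open>\<xi>\<close> does not occur. When that matrix is
  invertible, \<open>V (ys @ [\<xi>])\<close> is, as a function of \<open>\<xi>\<close>, the value at \<open>\<xi>\<close> of a monic polynomial
  of degree \<open>length ys\<close> with left coefficients, and it is the only such polynomial that vanishes
  on \<open>ys\<close> (\<open>V_snoc_monic_annihilator\<close>, \<open>V_eq_monic_annihilator\<close>).

  Write \<open>M\<^sub>A(\<xi>)\<close> for this polynomial on the points \<open>x k\<close> with \<open>k \<in> A\<close>, so that
  \<open>x\<^bsub>A,i\<^esub> = M\<^sub>A(x i) \<cdot> x i \<cdot> M\<^sub>A(x i)\<^sup>-\<^sup>1\<close>. The monic polynomial \<open>M\<^sub>A(\<xi>) \<cdot> \<xi> - x\<^bsub>A,i\<^esub> \<cdot> M\<^sub>A(\<xi>)\<close>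
  still vanishes on \<open>A\<close>, and it vanishes at \<open>x i\<close> by the choice of \<open>x\<^bsub>A,i\<^esub>\<close>. By uniqueness it
  is the polynomial of \<open>A \<union> {i}\<close> (\<open>V_insert\<close>). With \<open>u = x\<^bsub>A,j\<^esub>\<close> and \<open>v = x\<^bsub>A,i\<^esub>\<close>, its value at
  \<open>x j\<close> is \<open>(u - v) \<cdot> M\<^sub>A(x j)\<close>, whence \<open>x\<^bsub>A\<union>{i},j\<^esub> = (u - v) u (u - v)\<^sup>-\<^sup>1\<close>
  (\<open>pseudo_root_insert\<close>). Exchanging \<open>i\<close> and \<open>j\<close> gives
  \<open>x\<^bsub>A\<union>{j},i\<^esub> = (u - v) v (u - v)\<^sup>-\<^sup>1\<close>, and both relations become identities in \<open>u\<close> and \<open>v\<close>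
  (\<open>conjugates_by_difference\<close>).
\<close>

section \<open>Monic polynomial functions with left coefficients\<close>

definition monic_left_poly :: "nat \<Rightarrow> ('a::division_ring \<Rightarrow> 'a) \<Rightarrow> bool" where
  "monic_left_poly m f \<longleftrightarrow> (\<exists>c. \<forall>\<xi>. f \<xi> = \<xi> ^ m + (\<Sum>k<m. c k * \<xi> ^ k))"

text \<open>This is left multiplication by the linear factor \<open>t - v\<close>: for coefficients on the left,
  multiplication by \<open>t\<close> appends \<open>\<xi>\<close> to the value on the right, whereas the constant \<open>v\<close> enters on
  the left.\<close>

lemma monic_left_poly_linear_factor:
  fixes f :: "'a::division_ring \<Rightarrow> 'a"
  assumes "monic_left_poly m f"
  shows "monic_left_poly (Suc m) (\<lambda>\<xi>. f \<xi> * \<xi> - v * f \<xi>)"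
proof -
  from assms obtain c where c: "f \<xi> = \<xi> ^ m + (\<Sum>k<m. c k * \<xi> ^ k)" for \<xi>
    unfolding monic_left_poly_def by blast
  define d where "d k = (if k = 0 then 0 else c (k - 1)) - v * (if k = m then 1 else c k)" for k
  have "f \<xi> * \<xi> - v * f \<xi> = \<xi> ^ Suc m + (\<Sum>k<Suc m. d k * \<xi> ^ k)" for \<xi>
  proof -
    have "(\<Sum>k<Suc m. (if k = 0 then 0 else c (k - 1)) * \<xi> ^ k) = (\<Sum>k<m. c k * \<xi> ^ k) * \<xi>"
      by (subst sum.lessThan_Suc_shift) (simp add: sum_distrib_right mult.assoc power_commutes)
    moreover have "(\<Sum>k<Suc m. v * (if k = m then 1 else c k) * \<xi> ^ k)
        = v * (\<xi> ^ m + (\<Sum>k<m. c k * \<xi> ^ k))"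
      by (simp add: sum_distrib_left mult.assoc distrib_left add.commute)
    ultimately show ?thesis
      by (simp only: d_def c left_diff_distrib sum_subtractf)
        (simp add: algebra_simps power_commutes)
  qed
  then show ?thesis
    unfolding monic_left_poly_def by blast
qed

section \<open>The quasideterminant V as a monic annihilator\<close>

text \<open>The inverse is unique by associativity alone, so the description behind \<open>mat_inv\<close> is proper
  also over a division ring that is not commutative.\<close>

lemma inverts_mat_mat_inv:
  fixes M :: "'a::division_ring mat"
  assumes "invertible_mat M"
  shows "inverts_mat M (mat_inv M) \<and> inverts_mat (mat_inv M) M"
  unfolding mat_inv_def
proof (rule theI')
  have sq: "dim_row M = dim_col M"
    using assms unfolding invertible_mat_def by simp
  have dims: "N \<in> carrier_mat (dim_row M) (dim_row M)"
    if "inverts_mat M N \<and> inverts_mat N M" for N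
    using that sq unfolding inverts_mat_def carrier_mat_def
    by (metis (mono_tags, lifting) index_mult_mat(2,3) index_one_mat(2,3) mem_Collect_eq)
  have "N = N'" if N: "inverts_mat M N \<and> inverts_mat N M"
    and N': "inverts_mat M N' \<and> inverts_mat N' M" for N N'
  proof -
    let ?n = "dim_row M"
    have M: "M \<in> carrier_mat ?n ?n"
      using sq by auto
    have NM: "N * M = 1\<^sub>m ?n" and MN': "M * N' = 1\<^sub>m ?n"
      using N N' dims[OF N] unfolding inverts_mat_def by auto
    have "N = N * (M * N')"
      using MN' dims[OF N] by simp
    also have "\<dots> = N * M * N'"
      using assoc_mult_mat[OF dims[OF N] M dims[OF N']] by simp
    also have "\<dots> = N'"
      using NM dims[OF N'] by simp
    finally show ?thesis .
  qed
  then show "\<exists>!N. inverts_mat M N \<and> inverts_mat N M"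
    using assms unfolding invertible_mat_def by blast
qed

lemma dim_vandermonde_mat:
  "dim_row (vandermonde_mat ys) = length ys" "dim_col (vandermonde_mat ys) = length ys"
  by (simp_all add: vandermonde_mat_def)

lemma index_vandermonde_mat:
  "p < length ys \<Longrightarrow> q < length ys
    \<Longrightarrow> vandermonde_mat ys $$ (p, q) = ys ! q ^ (length ys - 1 - p)"
  by (simp add: vandermonde_mat_def)

lemma mat_delete_vandermonde:
  "mat_delete (vandermonde_mat (ys @ [\<xi>])) 0 (length ys) = vandermonde_mat ys"
  by (rule eq_matI) (auto simp: mat_delete_def vandermonde_mat_def nth_append)

lemma V_defined_snoc: "V_defined (ys @ [\<xi>]) \<longleftrightarrow> invertible_mat (vandermonde_mat ys)"
  by (simp add: V_defined_def quasidet_defined_def mat_delete_vandermonde dim_vandermonde_mat)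

lemma invertible_vandermonde_Nil: "invertible_mat (vandermonde_mat [])"
  unfolding invertible_mat_def inverts_mat_def
  by (auto simp: vandermonde_mat_def intro!: exI[of _ "1\<^sub>m 0"])

context
  fixes ys :: "'a::division_ring list"
  assumes invertible: "invertible_mat (vandermonde_mat ys)"
begin

private abbreviation "m \<equiv> length ys"
private abbreviation "N \<equiv> mat_inv (vandermonde_mat ys)"

lemma vandermonde_inverse_dims: "dim_row N = m" "dim_col N = m"
proof -
  have "dim_col (vandermonde_mat ys * N) = m" "dim_col (N * vandermonde_mat ys) = dim_row N"
    using inverts_mat_mat_inv[OF invertible]
    by (simp_all add: inverts_mat_def vandermonde_mat_def)
  then show "dim_row N = m" "dim_col N = m"
    by (simp_all add: vandermonde_mat_def)
qed

lemma vandermonde_inverse_left: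
  assumes "q < m" "r < m"
  shows "(\<Sum>p<m. N $$ (q, p) * ys ! r ^ (m - 1 - p)) = (if q = r then 1 else 0)"
proof -
  have "(N * vandermonde_mat ys) $$ (q, r) = 1\<^sub>m m $$ (q, r)"
    using inverts_mat_mat_inv[OF invertible]
    by (simp add: inverts_mat_def vandermonde_inverse_dims)
  moreover have "(N * vandermonde_mat ys) $$ (q, r) = (\<Sum>p<m. N $$ (q, p) * ys ! r ^ (m - 1 - p))"
    using assms
    by (simp add: scalar_prod_def vandermonde_inverse_dims dim_vandermonde_mat index_vandermonde_mat
        atLeast0LessThan)
  ultimately show ?thesis
    using assms by simp
qed

lemma vandermonde_inverse_right:
  assumes "p < m" "s < m"
  shows "(\<Sum>q<m. ys ! q ^ (m - 1 - p) * N $$ (q, s)) = (if p = s then 1 else 0)"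
proof -
  have "(vandermonde_mat ys * N) $$ (p, s) = 1\<^sub>m m $$ (p, s)"
    using inverts_mat_mat_inv[OF invertible]
    by (simp add: inverts_mat_def vandermonde_mat_def)
  moreover have "(vandermonde_mat ys * N) $$ (p, s) = (\<Sum>q<m. ys ! q ^ (m - 1 - p) * N $$ (q, s))"
    using assms
    by (simp add: scalar_prod_def vandermonde_inverse_dims dim_vandermonde_mat index_vandermonde_mat
        atLeast0LessThan)
  ultimately show ?thesis
    using assms by simp
qed

lemma V_snoc:
  "V (ys @ [\<xi>]) = \<xi> ^ m - (\<Sum>q<m. ys ! q ^ m * (\<Sum>p<m. N $$ (q, p) * \<xi> ^ (m - 1 - p)))"
  unfolding V_def quasidet_def Let_def
  by (simp add: mat_delete_vandermonde)
    (simp add: vandermonde_mat_def[of "ys @ [\<xi>]"] scalar_prod_def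
      vandermonde_inverse_dims nth_append atLeast0LessThan)

text \<open>The coefficients are minus the product of the row of leading terms \<open>(ys ! q) ^ m\<close> with the
  inverse Vandermonde matrix; at an entry of \<open>ys\<close> the inverse cancels and the row itself remains.\<close>

lemma V_snoc_monic_annihilator:
  "monic_left_poly m (\<lambda>\<xi>. V (ys @ [\<xi>]))" "y \<in> set ys \<Longrightarrow> V (ys @ [y]) = 0"
proof -
  define c where "c k = - (\<Sum>q<m. ys ! q ^ m * N $$ (q, m - Suc k))" for k
  have "V (ys @ [\<xi>]) = \<xi> ^ m + (\<Sum>k<m. c k * \<xi> ^ k)" for \<xi>
  proof -
    have "(\<Sum>k<m. c k * \<xi> ^ k) = (\<Sum>p<m. c (m - Suc p) * \<xi> ^ (m - Suc p))"
      by (rule sum.nat_diff_reindex[symmetric])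
    also have "\<dots> = (\<Sum>p<m. - (\<Sum>q<m. ys ! q ^ m * (N $$ (q, p) * \<xi> ^ (m - 1 - p))))"
      by (rule sum.cong) (auto simp: c_def sum_distrib_right mult.assoc)
    also have "\<dots> = - (\<Sum>q<m. ys ! q ^ m * (\<Sum>p<m. N $$ (q, p) * \<xi> ^ (m - 1 - p)))"
      by (simp only: sum_negf sum_distrib_left) (subst sum.swap, rule refl)
    finally show ?thesis
      by (simp add: V_snoc)
  qed
  then show "monic_left_poly m (\<lambda>\<xi>. V (ys @ [\<xi>]))"
    unfolding monic_left_poly_def by blast
next
  assume "y \<in> set ys"
  then obtain r where r: "r < m" "y = ys ! r"
    by (auto simp: in_set_conv_nth)
  have "(\<Sum>q<m. ys ! q ^ m * (\<Sum>p<m. N $$ (q, p) * y ^ (m - 1 - p)))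
      = (\<Sum>q<m. ys ! q ^ m * (if q = r then 1 else 0))"
    using r by (intro sum.cong) (simp_all only: r(2) vandermonde_inverse_left lessThan_iff)
  also have "\<dots> = y ^ m"
    using r by (simp add: if_distrib[of "(*) _"] cong: if_cong)
  finally show "V (ys @ [y]) = 0"
    by (simp add: V_snoc)
qed

text \<open>The vanishing of a monic polynomial on \<open>ys\<close> expresses the row of leading terms through the
  lower rows of the Vandermonde matrix. In the formula for \<open>V\<close> these rows cancel against the
  inverse matrix, and the coefficients of the polynomial are what is left.\<close>

lemma V_eq_monic_annihilator:
  assumes "monic_left_poly m f" and zero: "\<And>y. y \<in> set ys \<Longrightarrow> f y = 0"
  shows "V (ys @ [\<xi>]) = f \<xi>"
proof -
  from assms(1) obtain c where c: "\<And>t. f t = t ^ m + (\<Sum>k<m. c k * t ^ k)"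
    unfolding monic_left_poly_def by blast
  \<comment> \<open>Row \<open>p\<close> of the matrix holds the powers of exponent \<open>m - 1 - p\<close>.\<close>
  define d where "d p = c (m - 1 - p)" for p
  have f: "f t = t ^ m + (\<Sum>p<m. d p * t ^ (m - 1 - p))" for t
    using sum.nat_diff_reindex[of "\<lambda>k. c k * t ^ k" m] by (simp add: c d_def)
  have top: "ys ! q ^ m = - (\<Sum>p<m. d p * ys ! q ^ (m - 1 - p))" if "q < m" for q
    using zero[of "ys ! q"] that f[of "ys ! q"] by (simp add: eq_neg_iff_add_eq_0)
  have "(\<Sum>q<m. ys ! q ^ m * (\<Sum>s<m. N $$ (q, s) * \<xi> ^ (m - 1 - s)))
      = (\<Sum>q<m. - (\<Sum>s<m. \<Sum>p<m. d p * (ys ! q ^ (m - 1 - p) * N $$ (q, s)) * \<xi> ^ (m - 1 - s)))"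
    by (rule sum.cong) (simp_all add: top sum_distrib_left sum_distrib_right mult.assoc sum_negf)
  also have "\<dots> = - (\<Sum>s<m. \<Sum>p<m. \<Sum>q<m. d p * (ys ! q ^ (m - 1 - p) * N $$ (q, s)) * \<xi> ^ (m - 1 - s))"
    by (simp only: sum_negf) (subst sum.swap, subst (2) sum.swap, rule refl)
  also have "\<dots> = - (\<Sum>s<m. \<Sum>p<m. d p * (if p = s then 1 else 0) * \<xi> ^ (m - 1 - s))"
    by (intro arg_cong[of _ _ uminus] sum.cong refl)
      (simp only: sum_distrib_left[symmetric] sum_distrib_right[symmetric]
        vandermonde_inverse_right lessThan_iff)
  also have "\<dots> = - (\<Sum>s<m. d s * \<xi> ^ (m - 1 - s))"
    by (intro arg_cong[of _ _ uminus] sum.cong refl)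
      (simp add: if_distrib[of "(*) _"] if_distrib[of "\<lambda>z. z * _"] cong: if_cong)
  finally show ?thesis
    by (simp add: V_snoc f)
qed

end

section \<open>Adding a point\<close>

text \<open>The right-hand side is the monic polynomial of \<open>ys\<close> multiplied on the left by a linear
  factor. This keeps the roots in \<open>ys\<close>, and the conjugate of \<open>y\<close> is the constant that makes \<open>y\<close> a
  root as well.\<close>

lemma V_insert:
  fixes ys zs :: "'a::division_ring list"
  assumes ys: "invertible_mat (vandermonde_mat ys)" and zs: "invertible_mat (vandermonde_mat zs)"
    and set: "set zs = insert y (set ys)" and len: "length zs = Suc (length ys)"
    and nz: "V (ys @ [y]) \<noteq> 0"
  shows "V (zs @ [\<xi>])
    = V (ys @ [\<xi>]) * \<xi> - V (ys @ [y]) * y * inverse (V (ys @ [y])) * V (ys @ [\<xi>])"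
proof (rule V_eq_monic_annihilator[OF zs])
  show "monic_left_poly (length zs)
      (\<lambda>\<xi>. V (ys @ [\<xi>]) * \<xi> - V (ys @ [y]) * y * inverse (V (ys @ [y])) * V (ys @ [\<xi>]))"
    unfolding len
    by (rule monic_left_poly_linear_factor[OF V_snoc_monic_annihilator(1)[OF ys]])
  show "V (ys @ [z]) * z - V (ys @ [y]) * y * inverse (V (ys @ [y])) * V (ys @ [z]) = 0"
    if "z \<in> set zs" for z
    using that V_snoc_monic_annihilator(2)[OF ys, of z] nz
    by (auto simp: set mult.assoc)
qed

text \<open>For \<open>A = {}\<close> the value of \<open>V\<close> is the empty product of linear factors, so the case
  distinction in the definition of \<open>pseudo_root\<close> can be dropped.\<close>

lemma V_singleton: "V [\<xi>] = 1"
  using V_snoc[OF invertible_vandermonde_Nil, of \<xi>] by simp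

lemma pseudo_root_eq:
  "pseudo_root x A i = V (pseudo_args x A i) * x i * inverse (V (pseudo_args x A i))"
  by (simp add: pseudo_root_def pseudo_args_def V_singleton)

lemma pseudo_root_definedD:
  assumes "pseudo_root_defined x A i"
  shows "invertible_mat (vandermonde_mat (map x (sorted_list_of_set A)))"
    and "V (pseudo_args x A i) \<noteq> 0"
  using assms invertible_vandermonde_Nil
  by (auto simp: pseudo_root_defined_def pseudo_args_def V_singleton V_defined_snoc)

text \<open>The value of the polynomial of \<open>A \<union> {i}\<close> at \<open>x j\<close> is \<open>(x\<^bsub>A,j\<^esub> - x\<^bsub>A,i\<^esub>)\<close> times that of
  the polynomial of \<open>A\<close>, and conjugation of \<open>x j\<close> by the latter gives \<open>x\<^bsub>A,j\<^esub>\<close>.\<close>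

lemma pseudo_root_insert:
  fixes x :: "nat \<Rightarrow> 'a::division_ring"
  assumes A: "finite A" "i \<notin> A"
    and i: "pseudo_root_defined x A i" and j: "pseudo_root_defined x A j"
    and ij: "pseudo_root_defined x (A \<union> {i}) j"
  defines "w \<equiv> pseudo_root x A j - pseudo_root x A i"
  shows "w \<noteq> 0" and "pseudo_root x (A \<union> {i}) j = w * pseudo_root x A j * inverse w"
proof -
  let ?Mi = "V (pseudo_args x A i)" and ?Mj = "V (pseudo_args x A j)"
  let ?M = "V (pseudo_args x (A \<union> {i}) j)"
  note nz = pseudo_root_definedD(2)[OF i] pseudo_root_definedD(2)[OF j]
    pseudo_root_definedD(2)[OF ij]
  have "?M = ?Mj * x j - ?Mi * x i * inverse ?Mi * ?Mj"
    using V_insert[OF pseudo_root_definedD(1)[OF i] pseudo_root_definedD(1)[OF ij],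
        of "x i" "x j"] A nz(1)
    by (simp add: pseudo_args_def set_insort_key)
  also have "\<dots> = w * ?Mj"
    using nz(2) by (simp add: w_def pseudo_root_eq left_diff_distrib mult.assoc)
  finally have M: "?M = w * ?Mj" .
  then show w: "w \<noteq> 0"
    using nz(3) by auto
  have "pseudo_root x (A \<union> {i}) j = w * ?Mj * x j * inverse (w * ?Mj)"
    using M by (simp only: pseudo_root_eq)
  also have "\<dots> = w * (?Mj * x j * inverse ?Mj) * inverse w"
    using w nz(2) by (simp add: nonzero_inverse_mult_distrib mult.assoc)
  finally show "pseudo_root x (A \<union> {i}) j = w * pseudo_root x A j * inverse w"
    by (simp only: pseudo_root_eq)
qed

section \<open>The relations between pseudo-roots\<close>

text \<open>For \<open>w = u - v\<close> the sums differ by \<open>w (u - v) w\<^sup>-\<^sup>1 - w = 0\<close>. For the products, \<open>v\<close>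
  is replaced by \<open>u - w\<close>: \<open>w u w\<^sup>-\<^sup>1 v = w u w\<^sup>-\<^sup>1 (u - w)\<close> and
  \<open>w v w\<^sup>-\<^sup>1 u = w (u - w) w\<^sup>-\<^sup>1 u\<close> are both \<open>w u w\<^sup>-\<^sup>1 u - w u\<close>.\<close>

lemma conjugates_by_difference:
  fixes u v :: "'a::division_ring"
  defines "w \<equiv> u - v"
  assumes "w \<noteq> 0"
  shows "w * u * inverse w + v = w * v * inverse w + u"
    and "w * u * inverse w * v = w * v * inverse w * u"
proof -
  have v: "v = u - w"
    by (simp add: w_def)
  have *: "w * (inverse w * z) = z" "inverse w * (w * z) = z" for z
    using assms(2) by (simp_all flip: mult.assoc)
  show "w * u * inverse w + v = w * v * inverse w + u"
    and "w * u * inverse w * v = w * v * inverse w * u"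
    unfolding v using assms(2) by (simp_all add: algebra_simps *)
qed

theorem theorem3p3p1:
  fixes scale :: "'k::field_char_0 \<Rightarrow> 'a::division_ring \<Rightarrow> 'a"
    and n :: nat and a x :: "nat \<Rightarrow> 'a" and A :: "nat set" and i j :: nat
  assumes "division_algebra scale"
    and "a 0 \<noteq> 0"
    and "generic_poly n a x"
    and "A \<subseteq> {1..n}" and "card A < n - 1"
    and "i \<in> {1..n} - A" and "j \<in> {1..n} - A" and "i \<noteq> j"
  shows "pseudo_root x (A \<union> {i}) j + pseudo_root x A i
           = pseudo_root x (A \<union> {j}) i + pseudo_root x A j
       \<and> pseudo_root x (A \<union> {i}) j * pseudo_root x A i
           = pseudo_root x (A \<union> {j}) i * pseudo_root x A j"
proof -
  have defined: "pseudo_root_defined x B k" if "B \<subseteq> {1..n}" "k \<in> {1..n} - B" for B k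
    using assms(3) that unfolding generic_poly_def by blast
  have "finite A"
    using assms(4) finite_subset by blast
  define u v where "u = pseudo_root x A j" and "v = pseudo_root x A i"
  have i: "pseudo_root_defined x A i" and j: "pseudo_root_defined x A j"
    and ij: "pseudo_root_defined x (A \<union> {i}) j" and ji: "pseudo_root_defined x (A \<union> {j}) i"
    using assms(4,6-8) by (auto intro!: defined)
  have nz: "u - v \<noteq> 0"
    and u: "pseudo_root x (A \<union> {i}) j = (u - v) * u * inverse (u - v)"
    using pseudo_root_insert[OF \<open>finite A\<close> _ i j ij] assms(6) by (simp_all add: u_def v_def)
  have "pseudo_root x (A \<union> {j}) i = (v - u) * v * inverse (v - u)"
    using pseudo_root_insert(2)[OF \<open>finite A\<close> _ j i ji] assms(7) by (simp add: u_def v_def)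
  \<comment> \<open>Conjugation by \<open>v - u = - (u - v)\<close> is conjugation by \<open>u - v\<close>.\<close>
  also have "\<dots> = (u - v) * v * inverse (u - v)"
    by (simp only: minus_diff_eq[of u v, symmetric] inverse_minus_eq mult_minus_left
        mult_minus_right minus_minus)
  finally show ?thesis
    using conjugates_by_difference[OF nz] u by (simp add: u_def v_def)
qed

end
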